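(* Let $h<0$ and $0<\epsilon<|h|^{-1/\alpha}$. Compare the reduced non-smoothed ("real") flow on $\Sigma_{h,0}$ with the reduced smoothed flow on $\Sigma_{h,\epsilon}$, outside the collision manifold (i.e. for $r>0$). (i) Case $\alpha=2$: all orbits of the real flow are leading to/escaping from collision, whereas all orbits of the smoothed flow are periodic. The real and smoothed flows are not topologically equivalent. (ii) Case $\alpha>2$: all orbits of the real flow are leading to/escaping from collision. For the smoothed flow, the orbit with angular momentum $c=0$ is an ejection-collision orbit (with no spin), whose maximal distance is $\sqrt{(1/|h|)^{2/\alpha}-\epsilon^2}$. For $c\neq 0$, and for $h$ such that the orbit $\Sigma_{h,\epsilon}\cap\Gamma_c$ is non-void, the orbits of the smoothed flow are periodic, provided that $\epsilon$ is small enough. The real and smoothed flows are not topologically equivalent.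
   Context: A unit-mass particle moves in the plane under the potential $U_\delta(r)=-1/(r^2+\delta^2)^{\alpha/2}$, $\delta\ge 0$, where $\delta=0$ is the non-smoothed ("real") problem and $\delta=\epsilon>0$ the smoothed one. The Hamiltonian in polar coordinates is $\frac12(p_r^2+p_\theta^2/r^2)+U_\delta(r)$. With $u=p_\theta r^{(\alpha-2)/2}$, $v=p_r r^{\alpha/2}$, $d\tau=r^{-(\alpha+2)/2}dt$, and after factoring out the angle $\theta$, the reduced equations on $(r,v,u)\in[0,\infty)\times\mathbb{R}\times\mathbb{R}$ are $$r'=rv,\qquad v'=u^2+\frac{\alpha}{2}v^2-\frac{\alpha r^{\alpha+2}}{(r^2+\delta^2)^{\alpha/2+1}},\qquad u'=\frac{\alpha-2}{2}\,uv,$$ where $'=d/d\tau$ (for $\delta=0$ the last term of $v'$ is the constant $-\alpha$). The reduced energy surface for energy $h<0$ is the invariant set $$\Sigma_{h,\delta}=\Big\{(r,v,u)\in[0,\infty)\times\mathbb{R}^2 : u^2+v^2=\frac{2r^\alpha}{(r^2+\delta^2)^{\alpha/2}}-2r^\alpha|h|\Big\}$$ (for $\delta=0$ the right-hand side is $2-2r^\alpha|h|$, also at $r=0$). For $\delta=0$ the invariant set $r=0$ is the collision manifold. For $\alpha\ge 2$ the conserved angular momentum $c$ gives the invariant surfaces $\Gamma_c=\{(r,v,u): u=c\,r^{(\alpha-2)/2}\}$, and the orbit with energy $h$ and angular momentum $c$ is $\Sigma_{h,\delta}\cap\Gamma_c$. An orbit leading to (escaping from) collision is one along which $r\to 0$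 asymptotically in forward (backward) time $\tau$. Two flows are topologically equivalent if there is a homeomorphism between their phase spaces mapping orbits onto orbits and preserving the direction of time.
   Formalization: In (i), "all orbits of the smoothed flow are periodic" fails in τ for c=0: that orbit tends to r=0 as τ→±∞. It is stated in τ for c≠0, and for every planar motion of energy h (c=0 included) the reduced state is shown periodic in physical time t. *)

theory Defs
  imports "HOL-Analysis.Analysis"
begin

text \<open>
  States of the reduced system are triples \<open>(r, v, u)\<close>, with \<open>u = p\<^sub>\<theta> * r powr ((\<alpha> - 2) / 2)\<close>,
  \<open>v = p\<^sub>r * r powr (\<alpha> / 2)\<close>, and time \<open>\<tau>\<close> with \<open>d\<tau> = r powr (- (\<alpha> + 2) / 2) dt\<close>; the angle, which has been factored out,
  satisfies \<open>d\<theta>/d\<tau> = u\<close>. The case \<open>\<delta> = 0\<close> is written separately because \<open>x / 0 = 0\<close>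
  would give the wrong values at \<open>r = 0\<close>.
\<close>

type_synonym state = "real \<times> real \<times> real"

definition reduced_field :: "real \<Rightarrow> real \<Rightarrow> state \<Rightarrow> state" where
  "reduced_field \<alpha> \<delta> = (\<lambda>(r, v, u).
     (r * v,
      u\<^sup>2 + \<alpha> / 2 * v\<^sup>2
        - (if \<delta> = 0 then \<alpha> else \<alpha> * r powr (\<alpha> + 2) / (r\<^sup>2 + \<delta>\<^sup>2) powr (\<alpha> / 2 + 1)),
      (\<alpha> - 2) / 2 * u * v))"

definition energy_surface :: "real \<Rightarrow> real \<Rightarrow> real \<Rightarrow> state set" where
  "energy_surface \<alpha> h \<delta> = {(r, v, u). 0 \<le> r \<and>
     u\<^sup>2 + v\<^sup>2 = (if \<delta> = 0 then 2 else 2 * r powr \<alpha> / (r\<^sup>2 + \<delta>\<^sup>2) powr (\<alpha> / 2))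
                - 2 * r powr \<alpha> * \<bar>h\<bar>}"

text \<open>Only used for \<open>r > 0\<close>; for \<open>\<alpha> = 2\<close> note that \<open>0 powr 0 = 0\<close> in HOL.\<close>

definition momentum_surface :: "real \<Rightarrow> real \<Rightarrow> state set" where
  "momentum_surface \<alpha> c = {(r, v, u). u = c * r powr ((\<alpha> - 2) / 2)}"

text \<open>The phase space outside the collision manifold.\<close>

definition phase_space :: "real \<Rightarrow> real \<Rightarrow> real \<Rightarrow> state set" where
  "phase_space \<alpha> h \<delta> = energy_surface \<alpha> h \<delta> \<inter> {(r, v, u). 0 < r}"

text \<open>
  The orbits of the reduced flow are the ranges of its trajectories. For \<open>h < 0\<close> the energy surface
  is compact and \<open>r = 0\<close> is invariant, so all maximal solutions starting in the phase space
  are defined for all \<open>\<tau>\<close> and stay there; hence it is enough to consider solutions on the whole line.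
\<close>

definition trajectories :: "real \<Rightarrow> real \<Rightarrow> real \<Rightarrow> (real \<Rightarrow> state) set" where
  "trajectories \<alpha> h \<delta> = {x. \<forall>\<tau>. x \<tau> \<in> phase_space \<alpha> h \<delta> \<and>
     (x has_vector_derivative reduced_field \<alpha> \<delta> (x \<tau>)) (at \<tau>)}"

definition leads_to_collision :: "(real \<Rightarrow> state) \<Rightarrow> bool" where
  "leads_to_collision x \<longleftrightarrow> ((\<lambda>\<tau>. fst (x \<tau>)) \<longlongrightarrow> 0) at_top"

definition escapes_from_collision :: "(real \<Rightarrow> state) \<Rightarrow> bool" where
  "escapes_from_collision x \<longleftrightarrow> ((\<lambda>\<tau>. fst (x \<tau>)) \<longlongrightarrow> 0) at_bot"

text \<open>
  Equilibria count as periodic: an equilibrium of the reduced flow with \<open>r > 0\<close> is a circular motion,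
  whose angle has been factored out.
\<close>

definition periodic_curve :: "(real \<Rightarrow> 'a) \<Rightarrow> bool" where
  "periodic_curve x \<longleftrightarrow> (\<exists>T>0. \<forall>\<tau>. x (\<tau> + T) = x \<tau>)"

definition maximal_distance :: "(real \<Rightarrow> state) \<Rightarrow> real \<Rightarrow> bool" where
  "maximal_distance x d \<longleftrightarrow> (\<exists>\<tau>. fst (x \<tau>) = d) \<and> (\<forall>\<tau>. fst (x \<tau>) \<le> d)"

text \<open>
  Topological equivalence of the flows on \<open>M\<close> and \<open>N\<close> with trajectories \<open>X\<close> and \<open>Y\<close>: a homeomorphism
  maps orbits onto orbits and preserves the direction of time if it and its inverse map trajectories
  to trajectories up to an increasing change of time.
\<close>

definition topologically_equivalent ::
  "'a::topological_space set \<Rightarrow> (real \<Rightarrow> 'a) set \<Rightarrow> 'b::topological_space set \<Rightarrow> (real \<Rightarrow> 'b) set \<Rightarrow> bool"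
where
  "topologically_equivalent M X N Y \<longleftrightarrow> (\<exists>f g. homeomorphism M N f g \<and>
     (\<forall>x\<in>X. \<exists>\<sigma>. strict_mono \<sigma> \<and> surj \<sigma> \<and> f \<circ> x \<circ> \<sigma> \<in> Y) \<and>
     (\<forall>y\<in>Y. \<exists>\<sigma>. strict_mono \<sigma> \<and> surj \<sigma> \<and> g \<circ> y \<circ> \<sigma> \<in> X))"

text \<open>
  The smoothed problem (\<open>\<delta> > 0\<close>) in the plane, in physical time \<open>t\<close>, with position \<open>q\<close> and momentum
  \<open>p\<close>; the force is minus the gradient of \<open>- 1 / ((norm q)\<^sup>2 + \<delta>\<^sup>2) powr (\<alpha> / 2)\<close>. It is regular at \<open>q = 0\<close>. It is
  needed for zero angular momentum: there the motion runs through \<open>q = 0\<close>, whereas the corresponding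
  reduced trajectory only tends to the equilibrium \<open>(0, 0, 0)\<close> as \<open>\<tau> \<rightarrow> \<plusminus>\<infinity>\<close>, because
  \<open>r' = r v\<close> with \<open>v \<rightarrow> 0\<close>. So this orbit closes up in physical time but not in \<open>\<tau>\<close>.
\<close>

definition planar_motion ::
  "real \<Rightarrow> real \<Rightarrow> real \<Rightarrow> (real \<Rightarrow> complex) \<Rightarrow> (real \<Rightarrow> complex) \<Rightarrow> bool" where
  "planar_motion \<alpha> h \<delta> q p \<longleftrightarrow> (\<forall>t.
     (q has_vector_derivative p t) (at t) \<and>
     (p has_vector_derivative ((- \<alpha> / ((norm (q t))\<^sup>2 + \<delta>\<^sup>2) powr (\<alpha> / 2 + 1)) *\<^sub>R q t)) (at t) \<and>
     (norm (p t))\<^sup>2 / 2 - 1 / ((norm (q t))\<^sup>2 + \<delta>\<^sup>2) powr (\<alpha> / 2) = h)"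

text \<open>\<open>p\<^sub>r = (q \<bullet> p) / norm q\<close> and \<open>p\<^sub>\<theta> = Im (cnj q * p)\<close>.\<close>

definition reduced_state :: "real \<Rightarrow> complex \<Rightarrow> complex \<Rightarrow> state" where
  "reduced_state \<alpha> q p =
     (norm q,
      (q \<bullet> p) / norm q * norm q powr (\<alpha> / 2),
      Im (cnj q * p) * norm q powr ((\<alpha> - 2) / 2))"

end

theory Submission
  imports Defs
begin

text \<open>
  On a single orbit both flows reduce to one degree of freedom. For the real flow \<open>v\<close> strictly
  decreases, and so does \<open>p\<^sub>r\<close> for the smoothed one at \<open>c = 0\<close>; this forces \<open>r \<rightarrow> 0\<close> at both ends. For the
  smoothed flow at \<open>c \<noteq> 0\<close> the equation is reversible, so two turning points give a period; with fewer,
  the orbit would converge to a critical point on its own energy level. Since the effective energy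
  \<open>2 * s * ((s + \<epsilon>\<^sup>2) powr (- \<alpha> / 2) - \<bar>h\<bar>) - c\<^sup>2\<close>, \<open>s = r\<^sup>2\<close>, is unimodal, such a point is its strict
  maximum and the orbit is an equilibrium. The smoothed flow has an equilibrium and the real flow
  has none, so they are not equivalent.
\<close>

section \<open>Collision at both ends\<close>

lemma decrease_at_rate:
  fixes g :: "real \<Rightarrow> real"
  assumes "\<And>t. a \<le> t \<Longrightarrow> (g has_real_derivative g' t) (at t)"
    and "\<And>t. a \<le> t \<Longrightarrow> g' t \<le> - k" and "a \<le> t"
  shows "g t \<le> g a - k * (t - a)"
proof -
  have "g t + k * t \<le> g a + k * a"
  proof (rule DERIV_nonpos_imp_nonincreasing[OF assms(3)])
    fix s assume "a \<le> s" "s \<le> t"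
    then have "((\<lambda>s. g s + k * s) has_real_derivative g' s + k) (at s)"
      by (auto intro!: derivative_eq_intros assms(1))
    then show "\<exists>y. ((\<lambda>s. g s + k * s) has_real_derivative y) (at s) \<and> y \<le> 0"
      using assms(2)[OF \<open>a \<le> s\<close>] by (intro exI[of _ "g' s + k"]) auto
  qed
  then show ?thesis by (simp add: algebra_simps)
qed

lemma decrease_reaches:
  fixes g :: "real \<Rightarrow> real"
  assumes "\<And>t. a \<le> t \<Longrightarrow> (g has_real_derivative g' t) (at t)"
    and "\<And>t. a \<le> t \<Longrightarrow> g' t \<le> - k" and "0 < k"
  shows "\<exists>t\<ge>a. g t < b"
proof -
  \<comment> \<open>With this \<open>t\<close> the linear bound is at most
    \<open>g a - \<bar>g a - b\<bar> - 1\<close>, which lies below \<open>b\<close>.\<close>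
  define t where "t = a + (\<bar>g a - b\<bar> + 1) / k"
  have "a \<le> t" using \<open>0 < k\<close> by (simp add: t_def)
  moreover have "k * (t - a) = \<bar>g a - b\<bar> + 1" using \<open>0 < k\<close> by (simp add: t_def)
  ultimately show ?thesis
    using decrease_at_rate[OF assms(1,2), of a t] by (intro exI[of _ t]) auto
qed

text \<open>The rates \<open>\<phi>\<close> and \<open>\<psi>\<close> used below degenerate at
  \<open>r = 0\<close>, so a uniform positive bound is available only away from 0; there compactness
  gives it.\<close>

lemma continuous_positive_lower_bound:
  fixes \<phi> :: "real \<Rightarrow> real"
  assumes "continuous_on {0<..R} \<phi>" "\<And>r. 0 < r \<Longrightarrow> r \<le> R \<Longrightarrow> 0 < \<phi> r" "0 < a" "a \<le> R"
  shows "\<exists>k>0. \<forall>r\<in>{a..R}. k \<le> \<phi> r"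
proof -
  have "continuous_on {a..R} \<phi>"
    using assms(3) by (intro continuous_on_subset[OF assms(1)]) auto
  then obtain r where "r \<in> {a..R}" "\<forall>s\<in>{a..R}. \<phi> r \<le> \<phi> s"
    using continuous_attains_inf[of "{a..R}" \<phi>] assms(4) by auto
  then show ?thesis using assms(2)[of r] assms(3) by (intro exI[of _ "\<phi> r"]) auto
qed

text \<open>If \<open>w\<close> stayed nonnegative, \<open>r\<close> would be nondecreasing and
  remain in the compact interval from \<open>r 0\<close> to \<open>R\<close>, where
  \<open>\<psi>\<close> is bounded below; then \<open>w\<close> would fall below 0 linearly. Once
  negative, \<open>w\<close> stays below a negative constant, so \<open>r\<close> decreases, and it
  cannot stay above any \<open>e > 0\<close> because \<open>\<phi>\<close> is bounded below
  there.\<close>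

lemma collision_forward:
  fixes r w :: "real \<Rightarrow> real"
  assumes r: "\<And>t. (r has_real_derivative w t * \<phi> (r t)) (at t)"
    and w: "\<And>t. (w has_real_derivative w' t) (at t)" "\<And>t. w' t \<le> - \<psi> (r t)"
    and range: "\<And>t. 0 < r t" "\<And>t. r t \<le> R"
    and \<phi>: "continuous_on {0<..R} \<phi>" "\<And>s. 0 < s \<Longrightarrow> s \<le> R \<Longrightarrow> 0 < \<phi> s"
    and \<psi>: "continuous_on {0<..R} \<psi>" "\<And>s. 0 < s \<Longrightarrow> s \<le> R \<Longrightarrow> 0 < \<psi> s"
  shows "(r \<longlongrightarrow> 0) at_top" and "\<exists>t. w t < 0"
proof -
  show "\<exists>t. w t < 0"
  proof (rule ccontr)
    assume "\<nexists>t. w t < 0"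
    then have w0: "0 \<le> w t" for t by (meson not_le)
    obtain k where k: "0 < k" "\<And>s. s \<in> {r 0..R} \<Longrightarrow> k \<le> \<psi> s"
      using continuous_positive_lower_bound[OF \<psi> range(1)[of 0] range(2)[of 0]] by blast
    have "r 0 \<le> r t" if "0 \<le> t" for t
      using that
    proof (rule DERIV_nonneg_imp_nondecreasing)
      fix s show "\<exists>y. (r has_real_derivative y) (at s) \<and> 0 \<le> y"
        using r[of s] w0[of s] \<phi>(2)[OF range(1)[of s] range(2)[of s]]
        by (intro exI[of _ "w s * \<phi> (r s)"]) auto
    qed
    then have "w' t \<le> - k" if "0 \<le> t" for t
      using w(2)[of t] k(2)[of "r t"] range(2)[of t] that by force
    then have "\<exists>t\<ge>0. w t < 0" by (rule decrease_reaches[OF w(1) _ k(1)])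
    then show False using w0 by (meson not_le)
  qed
  then obtain a where a: "w a < 0" by blast
  \<comment> \<open>Rate 0 in \<open>decrease_at_rate\<close> is plain monotonicity:
    \<open>w\<close> is nonincreasing because \<open>\<psi>\<close> is positive along the
    orbit.\<close>
  have wa: "w t \<le> w a" if "a \<le> t" for t
    using decrease_at_rate[of a w w' 0 t] w \<psi>(2) range that by (smt (verit, best) mult_zero_left)
  have decr: "r t \<le> r b" if "a \<le> b" "b \<le> t" for b t
    using that(2)
  proof (rule DERIV_nonpos_imp_nonincreasing)
    fix s assume "b \<le> s" "s \<le> t"
    then have "w s * \<phi> (r s) \<le> 0"
      using wa[of s] a that(1) \<phi>(2)[OF range(1)[of s] range(2)[of s]] by (intro mult_nonpos_nonneg) auto
    then show "\<exists>y. (r has_real_derivative y) (at s) \<and> y \<le> 0"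
      using r[of s] by blast
  qed
  show "(r \<longlongrightarrow> 0) at_top"
  proof (rule order_tendstoI)
    fix e :: real assume "e < 0"
    then show "\<forall>\<^sub>F t in at_top. e < r t"
      using range(1) by (auto intro!: always_eventually intro: less_trans)
  next
    fix e :: real assume "0 < e"
    have "\<exists>b\<ge>a. r b < e"
    proof (rule ccontr)
      assume "\<not> (\<exists>b\<ge>a. r b < e)"
      then have ge: "e \<le> r t" if "a \<le> t" for t using that by force
      obtain k where k: "0 < k" "\<And>s. s \<in> {e..R} \<Longrightarrow> k \<le> \<phi> s"
        using continuous_positive_lower_bound[OF \<phi> \<open>0 < e\<close>] ge[of a] range(2)[of a] by force
      have "w t * \<phi> (r t) \<le> - (- w a * k)" if "a \<le> t" for t
      proof -
        have "k \<le> \<phi> (r t)" using k(2)[of "r t"] ge[OF that] range(2) by auto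
        then have "- w a * k \<le> - w t * \<phi> (r t)"
          using wa[OF that] a k(1) by (intro mult_mono) auto
        then show ?thesis by simp
      qed
      moreover have "0 < - w a * k" using a k(1) by (simp add: mult_neg_pos)
      ultimately have "\<exists>t\<ge>a. r t < 0" by (intro decrease_reaches[OF r])
      then show False using range(1) by (meson less_asym)
    qed
    then obtain b where "a \<le> b" "r b < e" by blast
    then show "\<forall>\<^sub>F t in at_top. r t < e"
      using decr[of b] unfolding eventually_at_top_linorder by (intro exI[of _ b]) force
  qed
qed

text \<open>The hypotheses are invariant under the time reversal that sends \<open>r t\<close> to
  \<open>r (- t)\<close> and \<open>w t\<close> to \<open>- w (- t)\<close>, so the backward limit
  is a forward limit. Since \<open>w\<close> is positive somewhere and negative somewhere, it has a
  zero: the turning point where the distance will be maximal.\<close>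

lemma collision_both_ends:
  fixes r w :: "real \<Rightarrow> real"
  assumes r: "\<And>t. (r has_real_derivative w t * \<phi> (r t)) (at t)"
    and w: "\<And>t. (w has_real_derivative w' t) (at t)" "\<And>t. w' t \<le> - \<psi> (r t)"
    and range: "\<And>t. 0 < r t" "\<And>t. r t \<le> R"
    and \<phi>: "continuous_on {0<..R} \<phi>" "\<And>s. 0 < s \<Longrightarrow> s \<le> R \<Longrightarrow> 0 < \<phi> s"
    and \<psi>: "continuous_on {0<..R} \<psi>" "\<And>s. 0 < s \<Longrightarrow> s \<le> R \<Longrightarrow> 0 < \<psi> s"
  shows "(r \<longlongrightarrow> 0) at_top" and "(r \<longlongrightarrow> 0) at_bot" and "\<exists>t. w t = 0"
proof -
  show "(r \<longlongrightarrow> 0) at_top"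
    by (rule collision_forward(1)[OF r w range \<phi> \<psi>]) simp_all
  have r': "((\<lambda>t. r (- t)) has_real_derivative - w (- t) * \<phi> (r (- t))) (at t)" for t
    using r[of "- t"] unfolding DERIV_mirror by simp
  have w': "((\<lambda>t. - w (- t)) has_real_derivative w' (- t)) (at t)" for t
    using DERIV_minus[OF w(1)[of "- t", unfolded DERIV_mirror]] by simp
  show "(r \<longlongrightarrow> 0) at_bot"
    unfolding filterlim_at_bot_mirror
    by (rule collision_forward(1)[OF r' w' w(2) range \<phi> \<psi>]) simp_all
  have "\<exists>t. w t < 0" by (rule collision_forward(2)[OF r w range \<phi> \<psi>]) simp_all
  moreover have "\<exists>t. - w (- t) < 0"
    by (rule collision_forward(2)[OF r' w' w(2) range \<phi> \<psi>]) simp_all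
  ultimately obtain a b where ab: "w a < 0" "0 < w b" by auto
  have "connected (w ` UNIV)"
    by (intro connected_continuous_image continuous_at_imp_continuous_on ballI DERIV_isCont[OF w(1)]) simp
  then have "0 \<in> range w"
    using ab connectedD_interval[of "w ` UNIV" "w a" "w b" 0] by simp
  then show "\<exists>t. w t = 0" by (metis imageE)
qed

section \<open>Periodicity of reversible second-order equations\<close>

text \<open>By the mean value theorem each increment over a unit interval is a value of
  \<open>g'\<close> at a later time. The increments tend to 0 and these values tend to
  \<open>l\<close>.\<close>

lemma limit_of_derivative_zero:
  fixes g :: "real \<Rightarrow> real"
  assumes g: "\<And>t. (g has_real_derivative g' t) (at t)"
    and lim: "(g \<longlongrightarrow> z) at_top" "(g' \<longlongrightarrow> l) at_top"
  shows "l = 0"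
proof -
  have "\<exists>s. n < s \<and> s < n + 1 \<and> g (n + 1) - g n = g' s" for n :: real
    using MVT2[of n "n + 1" g g'] g by auto
  then obtain s where s: "\<And>n. n < s n" "\<And>n. g (n + 1) - g n = g' (s n)" by metis
  have "filterlim s at_top at_top"
    using s(1) by (intro filterlim_at_top_mono[OF filterlim_ident] always_eventually) (auto intro: less_imp_le)
  then have "((\<lambda>n. g' (s n)) \<longlongrightarrow> l) at_top" using lim(2) by (rule filterlim_compose[rotated])
  moreover have "filterlim (\<lambda>n::real. n + 1) at_top at_top"
    by (rule filterlim_at_top_mono[OF filterlim_ident]) auto
  then have "((\<lambda>n. g (n + 1) - g n) \<longlongrightarrow> z - z) at_top"
    by (intro tendsto_diff lim(1) filterlim_compose[OF lim(1)])
  ultimately show ?thesis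
    unfolding s(2) by (metis diff_self tendsto_unique trivial_limit_at_top_linorder)
qed

lemma mono_bounded_convergent_at_top:
  fixes g :: "real \<Rightarrow> real"
  assumes mono: "\<And>s t. a \<le> s \<Longrightarrow> s \<le> t \<Longrightarrow> g s \<le> g t" and bound: "\<And>t. g t \<le> B"
  shows "\<exists>z. (g \<longlongrightarrow> z) at_top"
proof
  have bdd: "bdd_above (g ` {a..})" using bound by (auto simp: bdd_above_def)
  show "(g \<longlongrightarrow> (SUP t\<in>{a..}. g t)) at_top"
  proof (rule order_tendstoI)
    fix e assume "e < (SUP t\<in>{a..}. g t)"
    then obtain b where "a \<le> b" "e < g b" using less_cSUP_iff[OF _ bdd] by auto
    then show "\<forall>\<^sub>F t in at_top. e < g t"
      using mono[of b] unfolding eventually_at_top_linorder by (intro exI[of _ b]) force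
  next
    fix e assume e: "(SUP t\<in>{a..}. g t) < e"
    have "g t < e" if "a \<le> t" for t
      using cSUP_upper[OF _ bdd, of t] that e by auto
    then show "\<forall>\<^sub>F t in at_top. g t < e"
      unfolding eventually_at_top_linorder by blast
  qed
qed

lemma derivative_translate_reflect:
  fixes g :: "real \<Rightarrow> real"
  assumes g: "\<And>t. (g has_real_derivative g' t) (at t)"
  shows "((\<lambda>s. g (a + s)) has_real_derivative g' (a + s)) (at s)"
    and "((\<lambda>s. g (a - s)) has_real_derivative - g' (a - s)) (at s)"
  using DERIV_shift[of g "g' (a + s)" s a] g[of "a + s"]
    DERIV_shift[of "\<lambda>s. g (- s)" "- g' (a - s)" s "- a"] DERIV_mirror[of g "g' (a - s)" "s - a"] g[of "a - s"]
  by (simp_all add: add.commute)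

text \<open>The equation is reversible: reflecting a solution in a time \<open>\<theta>\<close> with
  zero velocity gives a solution with the same data at \<open>\<theta>\<close>. Uniqueness is proved
  directly by a Gronwall estimate for the difference of the two.\<close>

lemma second_order_symmetric:
  fixes x y f f' :: "real \<Rightarrow> real"
  assumes x: "\<And>t. (x has_real_derivative y t) (at t)"
    and y: "\<And>t. (y has_real_derivative f (x t)) (at t)"
    and range: "\<And>t. x t \<in> {a..b}"
    and f: "\<And>z. z \<in> {a..b} \<Longrightarrow> (f has_real_derivative f' z) (at z)" "continuous_on {a..b} f'"
    and turn: "y \<theta> = 0"
  shows "x (2 * \<theta> - t) = x t" and "y (2 * \<theta> - t) = - y t"
proof -
  have "bounded (f' ` {a..b})"
    by (intro compact_imp_bounded compact_continuous_image f(2)) auto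
  then obtain B where B: "0 < B" "\<And>z. z \<in> {a..b} \<Longrightarrow> norm (f' z) \<le> B"
    unfolding bounded_pos by auto
  have lip: "\<bar>f z - f w\<bar> \<le> B * \<bar>z - w\<bar>" if "z \<in> {a..b}" "w \<in> {a..b}" for z w
    using field_differentiable_bound[of "{a..b}" f f' B z w] f(1) B(2) that
    by (auto intro: has_field_derivative_at_within)
  define X where "X s = x (\<theta> + s) - x (\<theta> - s)" for s
  define Y where "Y s = y (\<theta> + s) + y (\<theta> - s)" for s
  \<comment> \<open>The derivative of \<open>X^2 + Y^2\<close> is at most \<open>1 + B\<close> times
    itself: 1 comes from the term \<open>2 * X * Y\<close>, and \<open>B\<close> from the Lipschitz
    bound on \<open>f\<close>. The exponential weight makes \<open>D\<close> nonincreasing from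
    \<open>D 0 = 0\<close>.\<close>
  define D where "D s = exp (- (1 + B) * s) * ((X s)\<^sup>2 + (Y s)\<^sup>2)" for s
  have sym0: "X s = 0 \<and> Y s = 0" if "0 \<le> s" for s
  proof -
    have "D s \<le> D 0"
      using that
    proof (rule DERIV_nonpos_imp_nonincreasing)
      fix s :: real
      let ?F = "f (x (\<theta> + s)) - f (x (\<theta> - s))"
      note dx = derivative_translate_reflect[where g = x, OF x]
        and dy = derivative_translate_reflect[where g = y, OF y]
      have X': "(X has_real_derivative Y s) (at s)"
        unfolding X_def[abs_def] Y_def
        using DERIV_diff[OF dx(1)[of \<theta> s] dx(2)[of \<theta> s]] by simp
      have Y': "(Y has_real_derivative ?F) (at s)"
        unfolding Y_def[abs_def]
        using DERIV_add[OF dy(1)[of \<theta> s] dy(2)[of \<theta> s]] by simp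
      have "((\<lambda>s. (X s)\<^sup>2 + (Y s)\<^sup>2) has_real_derivative 2 * X s * Y s + 2 * Y s * ?F) (at s)"
        using DERIV_add[OF DERIV_power[OF X', of 2] DERIV_power[OF Y', of 2]]
        by (simp add: algebra_simps)
      moreover have "((\<lambda>s. exp (- (1 + B) * s)) has_real_derivative - (1 + B) * exp (- (1 + B) * s)) (at s)"
        by (auto intro!: derivative_eq_intros)
      ultimately have D': "(D has_real_derivative - (1 + B) * exp (- (1 + B) * s) * ((X s)\<^sup>2 + (Y s)\<^sup>2)
          + (2 * X s * Y s + 2 * Y s * ?F) * exp (- (1 + B) * s)) (at s)"
        unfolding D_def[abs_def] by (rule DERIV_mult[rotated])
      have F: "\<bar>?F\<bar> \<le> B * \<bar>X s\<bar>" unfolding X_def by (intro lip range)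
      have "2 * Y s * ?F \<le> 2 * \<bar>Y s\<bar> * \<bar>?F\<bar>"
        using abs_ge_self[of "2 * Y s * ?F"] by (simp add: abs_mult)
      also have "\<dots> \<le> 2 * \<bar>Y s\<bar> * (B * \<bar>X s\<bar>)"
        by (intro mult_left_mono F) auto
      also have "\<dots> = B * (2 * \<bar>X s\<bar> * \<bar>Y s\<bar>)" by simp
      also have "\<dots> \<le> B * ((X s)\<^sup>2 + (Y s)\<^sup>2)"
        using B(1) sum_squares_bound[of "\<bar>X s\<bar>" "\<bar>Y s\<bar>"] by (intro mult_left_mono) auto
      finally have "2 * X s * Y s + 2 * Y s * ?F - (1 + B) * ((X s)\<^sup>2 + (Y s)\<^sup>2) \<le> 0"
        using sum_squares_bound[of "X s" "Y s"] by (simp add: algebra_simps)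
      then show "\<exists>y. (D has_real_derivative y) (at s) \<and> y \<le> 0"
        using D' mult_nonneg_nonpos[OF exp_ge_zero[of "- (1 + B) * s"]]
        by (fastforce simp: algebra_simps)
    qed
    also have "D 0 = 0" using turn by (simp add: D_def X_def Y_def)
    finally have "(X s)\<^sup>2 + (Y s)\<^sup>2 \<le> 0"
      unfolding D_def by (metis exp_gt_zero mult_le_0_iff not_le)
    then show ?thesis by (simp add: sum_power2_le_zero_iff)
  qed
  \<comment> \<open>\<open>X\<close> is odd and \<open>Y\<close> is even in \<open>s\<close>, so
    negative times follow from positive ones.\<close>
  have "X s = 0 \<and> Y s = 0" for s
  proof (cases "0 \<le> s")
    case True then show ?thesis by (rule sym0)
  next
    case False
    then have "X (- s) = 0 \<and> Y (- s) = 0" by (intro sym0) auto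
    then show ?thesis by (auto simp: X_def Y_def)
  qed
  from this[of "t - \<theta>"] show "x (2 * \<theta> - t) = x t" "y (2 * \<theta> - t) = - y t"
    by (auto simp: X_def Y_def algebra_simps)
qed

text \<open>After the last turning point \<open>x\<close> is monotone and bounded, hence converges
  to some \<open>z\<close>. Then \<open>y\<close>, being plus or minus the root of
  \<open>\<Gamma> (x t)\<close> with a fixed sign, converges too, necessarily to 0; finally its
  derivative \<open>f (x t)\<close> converges to \<open>f z\<close>, which is 0 for the same
  reason.\<close>

lemma second_order_limit:
  fixes x y f \<Gamma> :: "real \<Rightarrow> real"
  assumes x: "\<And>t. (x has_real_derivative y t) (at t)"
    and y: "\<And>t. (y has_real_derivative f (x t)) (at t)"
    and range: "\<And>t. x t \<in> {a..b}"
    and f: "continuous_on {a..b} f"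
    and \<Gamma>: "continuous_on {a..b} \<Gamma>" "\<And>t. (y t)\<^sup>2 = \<Gamma> (x t)"
    and no_turn: "\<And>t. t0 < t \<Longrightarrow> y t \<noteq> 0"
  shows "\<exists>z\<in>{a..b}. f z = 0 \<and> \<Gamma> z = 0"
proof -
  have cont: "continuous_on S y" for S
    by (intro continuous_at_imp_continuous_on ballI DERIV_isCont[OF y])
  have "connected (y ` {t0<..})"
    by (intro connected_continuous_image cont) auto
  moreover have "0 \<notin> y ` {t0<..}" using no_turn by auto
  ultimately have "\<not> (y s \<le> 0 \<and> 0 \<le> y t)" if "t0 < s" "t0 < t" for s t
    using that connectedD_interval[of "y ` {t0<..}" "y s" "y t" 0] by auto
  then consider (pos) "\<And>t. t0 < t \<Longrightarrow> 0 < y t" | (neg) "\<And>t. t0 < t \<Longrightarrow> y t < 0"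
    by (metis linorder_le_less_linear not_le)
  \<comment> \<open>\<open>\<sigma>\<close> is the constant sign of \<open>y\<close> after
    \<open>t0\<close>; it turns the relation for the square of \<open>y\<close> into one for
    \<open>y\<close> itself.\<close>
  then obtain \<sigma> :: real where \<sigma>: "\<sigma> \<noteq> 0" "\<And>t. t0 < t \<Longrightarrow> y t = \<sigma> * sqrt ((y t)\<^sup>2)"
    and conv: "\<exists>z. (x \<longlongrightarrow> z) at_top"
  proof cases
    case pos
    have "x s \<le> x t" if "t0 + 1 \<le> s" "s \<le> t" for s t
      using that(2)
    proof (rule DERIV_nonneg_imp_nondecreasing)
      fix w assume "s \<le> w"
      then show "\<exists>y. (x has_real_derivative y) (at w) \<and> 0 \<le> y"
        using x[of w] pos[of w] that(1) by force
    qed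
    moreover have "x t \<le> b" for t using range[of t] by simp
    ultimately have "\<exists>z. (x \<longlongrightarrow> z) at_top" by (rule mono_bounded_convergent_at_top)
    then show ?thesis using that[of 1] pos by (simp add: less_imp_le)
  next
    case neg
    have "- x s \<le> - x t" if "t0 + 1 \<le> s" "s \<le> t" for s t
    proof -
      have "x t \<le> x s"
        using that(2)
      proof (rule DERIV_nonpos_imp_nonincreasing)
        fix w assume "s \<le> w"
        then show "\<exists>y. (x has_real_derivative y) (at w) \<and> y \<le> 0"
          using x[of w] neg[of w] that(1) by force
      qed
      then show ?thesis by simp
    qed
    moreover have "- x t \<le> - a" for t using range[of t] by simp
    ultimately have "\<exists>z. ((\<lambda>t. - x t) \<longlongrightarrow> z) at_top" by (rule mono_bounded_convergent_at_top)
    then have "\<exists>z. (x \<longlongrightarrow> z) at_top" by (metis tendsto_minus_cancel_left)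
    then show ?thesis using that[of "- 1"] neg by (force simp: less_imp_le)
  qed
  from conv obtain z where z: "(x \<longlongrightarrow> z) at_top" by blast
  have zab: "z \<in> {a..b}"
    by (rule Lim_in_closed_set[OF _ _ _ z]) (auto simp del: atLeastAtMost_iff intro!: always_eventually range)
  have comp: "((\<lambda>t. g (x t)) \<longlongrightarrow> g z) at_top" if "continuous_on {a..b} g" for g :: "real \<Rightarrow> real"
    by (rule continuous_on_tendsto_compose[OF that z zab]) (auto simp del: atLeastAtMost_iff intro!: always_eventually range)
  have "((\<lambda>t. \<sigma> * sqrt ((y t)\<^sup>2)) \<longlongrightarrow> \<sigma> * sqrt (\<Gamma> z)) at_top"
    unfolding \<Gamma>(2) by (intro tendsto_intros comp \<Gamma>(1))
  moreover have "\<forall>\<^sub>F t in at_top. \<sigma> * sqrt ((y t)\<^sup>2) = y t"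
    using eventually_gt_at_top[of t0] by eventually_elim (rule \<sigma>(2)[symmetric])
  ultimately have ylim: "(y \<longlongrightarrow> \<sigma> * sqrt (\<Gamma> z)) at_top"
    using tendsto_cong by fast
  then have "\<sigma> * sqrt (\<Gamma> z) = 0" by (rule limit_of_derivative_zero[OF x z])
  moreover from this have "f z = 0" using ylim limit_of_derivative_zero[OF y _ comp[OF f]] by auto
  ultimately show ?thesis using zab \<sigma>(1) by auto
qed

text \<open>Two reflections in distinct turning times compose to a translation by twice their
  distance, which is a period. With fewer turning times the orbit would converge to a critical point
  of its own level, and \<open>isolated\<close> makes that point the only admissible
  position.\<close>

lemma second_order_periodic:
  fixes x y f f' \<Gamma> :: "real \<Rightarrow> real"
  assumes x: "\<And>t. (x has_real_derivative y t) (at t)"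
    and y: "\<And>t. (y has_real_derivative f (x t)) (at t)"
    and range: "\<And>t. x t \<in> {a..b}"
    and f: "\<And>z. z \<in> {a..b} \<Longrightarrow> (f has_real_derivative f' z) (at z)" "continuous_on {a..b} f'"
    and \<Gamma>: "continuous_on {a..b} \<Gamma>" "\<And>t. (y t)\<^sup>2 = \<Gamma> (x t)"
    and isolated: "\<And>z w. z \<in> {a..b} \<Longrightarrow> f z = 0 \<Longrightarrow> \<Gamma> z = 0 \<Longrightarrow> w \<in> {a..b} \<Longrightarrow> 0 \<le> \<Gamma> w \<Longrightarrow> w = z"
  shows "\<exists>T>0. \<forall>t. x (t + T) = x t \<and> y (t + T) = y t"
proof (cases "\<exists>s t. s < t \<and> y s = 0 \<and> y t = 0")
  case True
  then obtain \<theta>1 \<theta>2 where \<theta>: "\<theta>1 < \<theta>2" "y \<theta>1 = 0" "y \<theta>2 = 0" by blast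
  have sym: "x (2 * \<theta> - t) = x t \<and> y (2 * \<theta> - t) = - y t" if "y \<theta> = 0" for \<theta> t
    by (intro conjI second_order_symmetric[OF x y range f] that)
  have shift: "t + 2 * (\<theta>2 - \<theta>1) = 2 * \<theta>2 - (2 * \<theta>1 - t)" for t by simp
  have "x (t + 2 * (\<theta>2 - \<theta>1)) = x t" "y (t + 2 * (\<theta>2 - \<theta>1)) = y t" for t
    unfolding shift using sym[OF \<theta>(2), of t] sym[OF \<theta>(3), of "2 * \<theta>1 - t"] by simp_all
  then show ?thesis using \<theta>(1) by (intro exI[of _ "2 * (\<theta>2 - \<theta>1)"]) auto
next
  case False
  \<comment> \<open>At most one zero of \<open>y\<close> exists; \<open>t0\<close> is that zero, or
    any time if there is none.\<close>
  have "\<exists>t0. \<forall>t>t0. y t \<noteq> 0" using False by metis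
  then obtain t0 where "\<And>t. t0 < t \<Longrightarrow> y t \<noteq> 0" by blast
  moreover have "continuous_on {a..b} f"
    by (intro continuous_at_imp_continuous_on ballI DERIV_isCont[OF f(1)])
  ultimately obtain z where z: "z \<in> {a..b}" "f z = 0" "\<Gamma> z = 0"
    using second_order_limit[OF x y range _ \<Gamma>] by blast
  \<comment> \<open>\<open>\<Gamma> (x t)\<close> is a square, hence nonnegative, so
    \<open>isolated\<close> identifies every \<open>x t\<close> with \<open>z\<close>.\<close>
  have "x t = z" for t
    using isolated[OF z range] \<Gamma>(2)[of t] by (metis zero_le_power2)
  moreover from this have "y t = 0" for t using \<Gamma>(2)[of t] z(3) by simp
  ultimately show ?thesis by (intro exI[of _ 1]) auto
qed

section \<open>The reduced flows\<close>

text \<open>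
  \<open>radial_energy\<close> is \<open>p\<^sub>r\<^sup>2 * r\<^sup>2\<close> as a function of \<open>s = r\<^sup>2\<close> on the orbit with angular momentum \<open>c\<close>
  and energy \<open>- H\<close>.
\<close>

definition radial_energy :: "real \<Rightarrow> real \<Rightarrow> real \<Rightarrow> real \<Rightarrow> real \<Rightarrow> real" where
  "radial_energy \<alpha> H \<epsilon> c s = 2 * s * ((s + \<epsilon>\<^sup>2) powr (- (\<alpha> / 2)) - H) - c\<^sup>2"

text \<open>The derivative of \<open>radial_energy\<close> in \<open>s\<close>, with the power
  factored out so that the linear bracket decides whether the first term is positive.\<close>

definition radial_slope :: "real \<Rightarrow> real \<Rightarrow> real \<Rightarrow> real \<Rightarrow> real" where
  "radial_slope \<alpha> H \<epsilon> s = 2 * (s + \<epsilon>\<^sup>2) powr (- (\<alpha> / 2) - 1) * (\<epsilon>\<^sup>2 - (\<alpha> / 2 - 1) * s) - 2 * H"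

lemma powr_split_one:
  fixes x a :: real
  assumes "0 < x"
  shows "x powr a = x * x powr (a - 1)"
  using assms by (simp add: powr_diff)

lemma radial_energy_has_derivative:
  assumes "0 < s + \<epsilon>\<^sup>2"
  shows "(radial_energy \<alpha> H \<epsilon> c has_real_derivative radial_slope \<alpha> H \<epsilon> s) (at s)"
proof -
  let ?B = "(s + \<epsilon>\<^sup>2) powr (- (\<alpha> / 2) - 1)"
  have "((\<lambda>s. 2 * s * ((s + \<epsilon>\<^sup>2) powr (- (\<alpha> / 2)) - H) - c\<^sup>2) has_real_derivative
      2 * ((s + \<epsilon>\<^sup>2) powr (- (\<alpha> / 2)) - H) + 2 * s * (- (\<alpha> / 2) * ?B)) (at s)"
    using assms by (auto intro!: derivative_eq_intros)
  moreover have "(s + \<epsilon>\<^sup>2) powr (- (\<alpha> / 2)) = (s + \<epsilon>\<^sup>2) * ?B"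
    by (rule powr_split_one[OF assms])
  ultimately show ?thesis
    unfolding radial_energy_def[abs_def] radial_slope_def by (simp add: algebra_simps)
qed

text \<open>A nonnegative slope at \<open>t\<close> needs a positive bracket to outweigh
  \<open>- 2 * H\<close>. Then, going back from \<open>t\<close> to \<open>s\<close>, the power
  strictly increases and the bracket does not decrease. Hence the slope can change sign only once,
  from positive to negative.\<close>

lemma radial_slope_less:
  assumes "2 \<le> \<alpha>" "0 < H" "\<epsilon> \<noteq> 0" "0 \<le> s" "s < t" "0 \<le> radial_slope \<alpha> H \<epsilon> t"
  shows "radial_slope \<alpha> H \<epsilon> t < radial_slope \<alpha> H \<epsilon> s"
proof (cases "0 < \<epsilon>\<^sup>2 - (\<alpha> / 2 - 1) * t")
  case True
  have "(t + \<epsilon>\<^sup>2) powr (- (\<alpha> / 2) - 1) < (s + \<epsilon>\<^sup>2) powr (- (\<alpha> / 2) - 1)"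
    using assms by (intro powr_less_mono2_neg) (auto intro: add_nonneg_pos)
  moreover have "\<epsilon>\<^sup>2 - (\<alpha> / 2 - 1) * t \<le> \<epsilon>\<^sup>2 - (\<alpha> / 2 - 1) * s"
    using assms by (simp add: mult_left_mono)
  ultimately show ?thesis
    unfolding radial_slope_def
    using True by (simp add: mult_less_le_imp_less)
next
  case False
  then have "radial_slope \<alpha> H \<epsilon> t \<le> - 2 * H"
    unfolding radial_slope_def by (simp add: mult_nonneg_nonpos)
  then show ?thesis using assms by linarith
qed

text \<open>The slope is positive before a critical point and negative after it, so the critical
  point is a strict global maximum on \<open>s \<ge> 0\<close>. This supplies the hypothesis
  \<open>isolated\<close> of \<open>second_order_periodic\<close>.\<close>

lemma radial_energy_peak:
  assumes "2 \<le> \<alpha>" "0 < H" "\<epsilon> \<noteq> 0" "0 \<le> z" "radial_slope \<alpha> H \<epsilon> z = 0"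
    and "0 \<le> w" "radial_energy \<alpha> H \<epsilon> c z \<le> radial_energy \<alpha> H \<epsilon> c w"
  shows "w = z"
proof (rule ccontr)
  assume "w \<noteq> z"
  have deriv: "(radial_energy \<alpha> H \<epsilon> c has_real_derivative radial_slope \<alpha> H \<epsilon> s) (at s)" if "0 \<le> s" for s
    using that assms(3) by (intro radial_energy_has_derivative) (auto intro: add_nonneg_pos)
  from \<open>w \<noteq> z\<close> consider "w < z" | "z < w" by linarith
  then have "radial_energy \<alpha> H \<epsilon> c w < radial_energy \<alpha> H \<epsilon> c z"
  proof cases
    case 1
    then obtain s where s: "w < s" "s < z"
      "radial_energy \<alpha> H \<epsilon> c z - radial_energy \<alpha> H \<epsilon> c w = (z - w) * radial_slope \<alpha> H \<epsilon> s"
      using MVT2[OF 1 deriv] assms(6) by auto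
    have "0 < radial_slope \<alpha> H \<epsilon> s"
      using radial_slope_less[OF assms(1-3), of s z] s assms(5,6) by simp
    then show ?thesis using s(3) 1 by (smt (verit) mult_pos_pos)
  next
    case 2
    then obtain s where s: "z < s" "s < w"
      "radial_energy \<alpha> H \<epsilon> c w - radial_energy \<alpha> H \<epsilon> c z = (w - z) * radial_slope \<alpha> H \<epsilon> s"
      using MVT2[OF 2 deriv] assms(4) by auto
    \<comment> \<open>A nonnegative slope at \<open>s\<close> would have to be smaller than the
      slope 0 at the earlier point \<open>z\<close>.\<close>
    have "radial_slope \<alpha> H \<epsilon> s < 0"
      using radial_slope_less[OF assms(1-3) assms(4) s(1)] assms(5) by linarith
    then show ?thesis using s(3) 2 mult_pos_neg[of "w - z" "radial_slope \<alpha> H \<epsilon> s"] by linarith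
  qed
  then show False using assms(7) by simp
qed

text \<open>Applied with \<open>s\<close> standing for \<open>r^2 + \<epsilon>^2\<close>, where the
  last hypothesis says that the kinetic energy is nonnegative.\<close>

lemma reach_bound:
  fixes \<alpha> H s :: real
  assumes "0 < \<alpha>" "0 < H" "0 < s" "H \<le> s powr (- (\<alpha> / 2))"
  shows "s \<le> (1 / H) powr (2 / \<alpha>)"
proof -
  have "(s powr (- (\<alpha> / 2))) powr (- (2 / \<alpha>)) \<le> H powr (- (2 / \<alpha>))"
    using assms by (intro powr_mono2') auto
  then show ?thesis
    using assms(1-3) by (simp add: powr_powr powr_minus powr_divide inverse_eq_divide)
qed

section \<open>Trajectories in coordinates\<close>

lemma trajectory_derivatives:
  assumes "x \<in> trajectories \<alpha> h \<delta>"
  defines "r \<equiv> \<lambda>t. fst (x t)" and "v \<equiv> \<lambda>t. fst (snd (x t))" and "u \<equiv> \<lambda>t. snd (snd (x t))"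
  shows "0 < r t"
    and "(r has_real_derivative v t * r t) (at t)"
    and "(v has_real_derivative (u t)\<^sup>2 + \<alpha> / 2 * (v t)\<^sup>2 - (if \<delta> = 0 then \<alpha> else
      \<alpha> * r t powr (\<alpha> + 2) / ((r t)\<^sup>2 + \<delta>\<^sup>2) powr (\<alpha> / 2 + 1))) (at t)"
    and "(u t)\<^sup>2 + (v t)\<^sup>2 = (if \<delta> = 0 then 2 else 2 * r t powr \<alpha> / ((r t)\<^sup>2 + \<delta>\<^sup>2) powr (\<alpha> / 2))
      - 2 * r t powr \<alpha> * \<bar>h\<bar>"
proof -
  have x: "x t \<in> phase_space \<alpha> h \<delta>" "(x has_vector_derivative reduced_field \<alpha> \<delta> (x t)) (at t)"
    using assms(1) by (auto simp: trajectories_def)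
  show "0 < r t" using x(1) by (auto simp: phase_space_def r_def)
  show "(u t)\<^sup>2 + (v t)\<^sup>2 = (if \<delta> = 0 then 2 else 2 * r t powr \<alpha> / ((r t)\<^sup>2 + \<delta>\<^sup>2) powr (\<alpha> / 2))
      - 2 * r t powr \<alpha> * \<bar>h\<bar>"
    using x(1) by (auto simp: phase_space_def energy_surface_def r_def v_def u_def)
  have "((\<lambda>t. snd (x t)) has_vector_derivative snd (reduced_field \<alpha> \<delta> (x t))) (at t)"
    by (rule bounded_linear.has_vector_derivative[OF bounded_linear_snd x(2)])
  from bounded_linear.has_vector_derivative[OF bounded_linear_fst this]
    bounded_linear.has_vector_derivative[OF bounded_linear_fst x(2)]
  show "(r has_real_derivative v t * r t) (at t)"
    "(v has_real_derivative (u t)\<^sup>2 + \<alpha> / 2 * (v t)\<^sup>2 - (if \<delta> = 0 then \<alpha> else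
      \<alpha> * r t powr (\<alpha> + 2) / ((r t)\<^sup>2 + \<delta>\<^sup>2) powr (\<alpha> / 2 + 1))) (at t)"
    by (simp_all add: has_real_derivative_iff_has_vector_derivative reduced_field_def split_beta
      r_def v_def u_def mult.commute split: if_splits)
qed

text \<open>Quotients are turned into negative powers, the form in which
  \<open>radial_energy\<close> and \<open>radial_slope\<close> are written.\<close>

lemma smoothed_trajectory:
  fixes x :: "real \<Rightarrow> state"
  assumes "x \<in> trajectories \<alpha> h \<epsilon>" "\<epsilon> \<noteq> 0"
  defines "r \<equiv> \<lambda>t. fst (x t)" and "v \<equiv> \<lambda>t. fst (snd (x t))" and "u \<equiv> \<lambda>t. snd (snd (x t))"
  shows "(v has_real_derivative (u t)\<^sup>2 + \<alpha> / 2 * (v t)\<^sup>2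
      - \<alpha> * r t powr \<alpha> * (r t)\<^sup>2 * ((r t)\<^sup>2 + \<epsilon>\<^sup>2) powr (- (\<alpha> / 2) - 1)) (at t)"
    and "(u t)\<^sup>2 + (v t)\<^sup>2 = 2 * r t powr \<alpha> * (((r t)\<^sup>2 + \<epsilon>\<^sup>2) powr (- (\<alpha> / 2)) - \<bar>h\<bar>)"
proof -
  have traj: "0 < r t"
    "(v has_real_derivative (u t)\<^sup>2 + \<alpha> / 2 * (v t)\<^sup>2
      - \<alpha> * r t powr (\<alpha> + 2) / ((r t)\<^sup>2 + \<epsilon>\<^sup>2) powr (\<alpha> / 2 + 1)) (at t)"
    "(u t)\<^sup>2 + (v t)\<^sup>2 = 2 * r t powr \<alpha> / ((r t)\<^sup>2 + \<epsilon>\<^sup>2) powr (\<alpha> / 2) - 2 * r t powr \<alpha> * \<bar>h\<bar>"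
    using trajectory_derivatives(1,3,4)[OF assms(1), of t] assms(2)
    by (simp_all add: r_def v_def u_def)
  have r: "r t powr (\<alpha> + 2) = r t powr \<alpha> * (r t)\<^sup>2"
    using traj(1) powr_realpow[of "r t" 2] by (simp add: powr_add)
  have "((r t)\<^sup>2 + \<epsilon>\<^sup>2) powr (- (\<alpha> / 2) - 1) = 1 / ((r t)\<^sup>2 + \<epsilon>\<^sup>2) powr (\<alpha> / 2 + 1)"
    using powr_minus_divide[of "(r t)\<^sup>2 + \<epsilon>\<^sup>2" "\<alpha> / 2 + 1"] by simp
  then show "(v has_real_derivative (u t)\<^sup>2 + \<alpha> / 2 * (v t)\<^sup>2
      - \<alpha> * r t powr \<alpha> * (r t)\<^sup>2 * ((r t)\<^sup>2 + \<epsilon>\<^sup>2) powr (- (\<alpha> / 2) - 1)) (at t)"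
    using traj(2) unfolding r by (simp add: mult.assoc)
  show "(u t)\<^sup>2 + (v t)\<^sup>2 = 2 * r t powr \<alpha> * (((r t)\<^sup>2 + \<epsilon>\<^sup>2) powr (- (\<alpha> / 2)) - \<bar>h\<bar>)"
    using traj(3) by (simp add: powr_minus_divide algebra_simps)
qed

lemma smoothed_reach:
  assumes "x \<in> trajectories \<alpha> h \<epsilon>" "\<epsilon> \<noteq> 0" "0 < \<alpha>" "h \<noteq> 0"
  shows "(fst (x t))\<^sup>2 + \<epsilon>\<^sup>2 \<le> (1 / \<bar>h\<bar>) powr (2 / \<alpha>)"
proof -
  have pos: "0 < fst (x t) powr \<alpha>" using trajectory_derivatives(1)[OF assms(1), of t] by simp
  have "0 \<le> fst (x t) powr \<alpha> * (((fst (x t))\<^sup>2 + \<epsilon>\<^sup>2) powr (- (\<alpha> / 2)) - \<bar>h\<bar>)"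
    using smoothed_trajectory(2)[OF assms(1,2), of t]
      sum_power2_ge_zero[of "snd (snd (x t))" "fst (snd (x t))"] by simp
  then have "\<bar>h\<bar> \<le> ((fst (x t))\<^sup>2 + \<epsilon>\<^sup>2) powr (- (\<alpha> / 2))"
    using pos by (simp add: zero_le_mult_iff)
  then show ?thesis
    using assms by (intro reach_bound) (auto intro: add_nonneg_pos)
qed

section \<open>Collision orbits: the real flow, and the smoothed flow with zero angular
  momentum\<close>

text \<open>Eliminating the square of \<open>v\<close> by the energy relation leaves \<open>v' = -
  \<alpha> * H * r powr \<alpha> - (\<alpha> / 2 - 1) * u^2\<close>, which is negative for
  \<open>\<alpha> \<ge> 2\<close>. So \<open>collision_both_ends\<close> applies with
  \<open>w = v\<close> and \<open>\<phi>\<close> the identity.\<close>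

lemma real_flow_collision:
  assumes "x \<in> trajectories \<alpha> h 0" "2 \<le> \<alpha>" "h < 0"
  shows "leads_to_collision x" and "escapes_from_collision x"
proof -
  define r where "r t = fst (x t)" for t
  define v where "v t = fst (snd (x t))" for t
  define u where "u t = snd (snd (x t))" for t
  define H where "H = \<bar>h\<bar>"
  have H: "0 < H" using assms(3) by (simp add: H_def)
  note traj = trajectory_derivatives[OF assms(1), folded r_def v_def u_def H_def, simplified]
  have v': "(u t)\<^sup>2 + \<alpha> * (v t)\<^sup>2 / 2 - \<alpha> \<le> - (\<alpha> * H * r t powr \<alpha>)" for t
  proof -
    have v2: "(v t)\<^sup>2 = 2 - 2 * r t powr \<alpha> * H - (u t)\<^sup>2" using traj(4)[of t] by simp
    have "(u t)\<^sup>2 + \<alpha> * (v t)\<^sup>2 / 2 - \<alpha> = - (\<alpha> * H * r t powr \<alpha>) - (\<alpha> / 2 - 1) * (u t)\<^sup>2"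
      unfolding v2 by (simp add: field_simps)
    moreover have "0 \<le> (\<alpha> / 2 - 1) * (u t)\<^sup>2" using assms(2) by simp
    ultimately show ?thesis by linarith
  qed
  have bound: "r t \<le> (1 / H) powr (1 / \<alpha>)" for t
  proof -
    have "r t powr \<alpha> * H \<le> 1"
      using traj(4)[of t] sum_power2_ge_zero[of "u t" "v t"] by linarith
    then have "r t powr \<alpha> \<le> 1 / H" using H by (simp add: field_simps)
    then have "(r t powr \<alpha>) powr (1 / \<alpha>) \<le> (1 / H) powr (1 / \<alpha>)"
      using assms(2) by (intro powr_mono2) auto
    then show ?thesis using assms(2) traj(1)[of t] by (simp add: powr_powr)
  qed
  have "(r \<longlongrightarrow> 0) at_top" "(r \<longlongrightarrow> 0) at_bot"
    using assms(2) H
    by (intro collision_both_ends[where w = v and \<phi> = "\<lambda>r. r" and \<psi> = "\<lambda>r. \<alpha> * H * r powr \<alpha>"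
        and R = "(1 / H) powr (1 / \<alpha>)", OF traj(2,3) v' traj(1) bound];
      force intro!: continuous_intros)+
  then show "leads_to_collision x" "escapes_from_collision x"
    by (simp_all add: leads_to_collision_def escapes_from_collision_def flip: r_def)
qed

text \<open>Here the monotone quantity is the radial momentum: without spin only the attractive
  force acts on it. At its zero the energy relation determines \<open>r\<close>, and the value is
  exactly the upper bound from \<open>smoothed_reach\<close>.\<close>

lemma smoothed_ejection_collision:
  assumes x: "x \<in> trajectories \<alpha> h \<epsilon>" "range x \<subseteq> momentum_surface \<alpha> 0"
    and "0 < \<alpha>" "h \<noteq> 0" "\<epsilon> \<noteq> 0"
  shows "leads_to_collision x" and "escapes_from_collision x" and "snd (snd (x t)) = 0"
    and "maximal_distance x (sqrt ((1 / \<bar>h\<bar>) powr (2 / \<alpha>) - \<epsilon>\<^sup>2))"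
proof -
  define r where "r t = fst (x t)" for t
  define v where "v t = fst (snd (x t))" for t
  define R where "R = sqrt ((1 / \<bar>h\<bar>) powr (2 / \<alpha>) - \<epsilon>\<^sup>2)"
  \<comment> \<open>\<open>w\<close> is \<open>p_r\<close>, and \<open>\<psi>\<close> is the size of
    the attractive force multiplied by
    \<open>dt/d\<tau> = r powr (\<alpha> / 2 + 1)\<close>.\<close>
  define w where "w = (\<lambda>t. v t * r t powr (- (\<alpha> / 2)))"
  define \<psi> where "\<psi> = (\<lambda>r. \<alpha> * r powr (\<alpha> / 2) * r\<^sup>2 * (r\<^sup>2 + \<epsilon>\<^sup>2) powr (- (\<alpha> / 2) - 1))"
  have u: "snd (snd (x t)) = 0" for t
    using subsetD[OF x(2) rangeI[of x t]] by (auto simp: momentum_surface_def)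
  then show "snd (snd (x t)) = 0" .
  note traj = trajectory_derivatives[OF x(1), folded r_def v_def]
    and smooth = smoothed_trajectory[OF x(1) assms(5), folded r_def v_def, unfolded u, simplified]
  have bound: "r t \<le> R" for t
    unfolding R_def using smoothed_reach[OF x(1) assms(5,3,4), of t, folded r_def]
    by (intro real_le_rsqrt) simp
  have dr: "(r has_real_derivative w t * r t powr (1 + \<alpha> / 2)) (at t)" for t
    using traj(1,2)[of t] by (simp add: w_def mult.assoc flip: powr_add)
  have dw: "(w has_real_derivative - \<psi> (r t)) (at t)" for t
  proof -
    let ?v' = "\<alpha> / 2 * (v t)\<^sup>2 - \<alpha> * r t powr \<alpha> * (r t)\<^sup>2 * ((r t)\<^sup>2 + \<epsilon>\<^sup>2) powr (- (\<alpha> / 2) - 1)"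
    have "((\<lambda>t. r t powr (- (\<alpha> / 2))) has_real_derivative
        - (\<alpha> / 2) * r t powr (- (\<alpha> / 2) - 1) * (v t * r t)) (at t)"
      using DERIV_fun_powr[OF traj(2)[of t] traj(1)[of t], of "- (\<alpha> / 2)"] by simp
    moreover have "r t powr (- (\<alpha> / 2)) = r t * r t powr (- (\<alpha> / 2) - 1)"
      by (rule powr_split_one[OF traj(1)])
    ultimately have "((\<lambda>t. r t powr (- (\<alpha> / 2))) has_real_derivative
        - (\<alpha> / 2) * r t powr (- (\<alpha> / 2)) * v t) (at t)"
      by (simp add: mult_ac)
    from DERIV_mult[OF smooth(1) this]
    have "(w has_real_derivative ?v' * r t powr (- (\<alpha> / 2)) +
        - (\<alpha> / 2) * r t powr (- (\<alpha> / 2)) * v t * v t) (at t)"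
      by (simp add: w_def)
    moreover have "r t powr (\<alpha> / 2) = r t powr \<alpha> * r t powr (- (\<alpha> / 2))"
      by (simp flip: powr_add)
    then have "?v' * r t powr (- (\<alpha> / 2)) + - (\<alpha> / 2) * r t powr (- (\<alpha> / 2)) * v t * v t = - \<psi> (r t)"
      by (simp add: \<psi>_def algebra_simps power2_eq_square)
    ultimately show ?thesis by simp
  qed
  have \<psi>: "continuous_on {0<..R} \<psi>" "0 < \<psi> s" if "0 < s" for s
    using assms(3,5) that unfolding \<psi>_def
    by (auto intro!: continuous_intros mult_pos_pos simp: add_nonneg_eq_0_iff intro: add_nonneg_pos)
  have \<phi>: "continuous_on {0<..R} (\<lambda>r. r powr (1 + \<alpha> / 2))"
    by (auto intro!: continuous_intros)
  \<comment> \<open>\<open>order_refl\<close> enters because \<open>w' = - \<psi> (r t)\<close>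
    holds exactly; \<open>zero_less_one\<close> discharges the positivity premise that the
    continuity fact shares with \<open>\<psi>(2)\<close>.\<close>
  note collision = collision_both_ends[where \<phi> = "\<lambda>r. r powr (1 + \<alpha> / 2)" and \<psi> = \<psi> and R = R,
      OF dr dw order_refl traj(1) bound \<phi> _ \<psi>(1)[OF zero_less_one] \<psi>(2)]
  have "(r \<longlongrightarrow> 0) at_top" "(r \<longlongrightarrow> 0) at_bot" "\<exists>t. w t = 0"
    by (rule collision; simp)+
  then show "leads_to_collision x" "escapes_from_collision x"
    by (simp_all add: leads_to_collision_def escapes_from_collision_def flip: r_def)
  from \<open>\<exists>t. w t = 0\<close> obtain t where "v t = 0" using traj(1) by (auto simp: w_def less_le)
  then have "((r t)\<^sup>2 + \<epsilon>\<^sup>2) powr (- (\<alpha> / 2)) = \<bar>h\<bar>"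
    using smooth(2)[of t] traj(1)[of t] by simp
  then have "\<bar>h\<bar> powr (- (2 / \<alpha>)) = (r t)\<^sup>2 + \<epsilon>\<^sup>2"
    using assms(3,5) by (auto simp: powr_powr add_nonneg_pos simp flip: \<open>_ = \<bar>h\<bar>\<close>)
  then have "r t = R"
    using assms(4) traj(1)[of t] by (simp add: R_def powr_minus powr_divide inverse_eq_divide)
  then show "maximal_distance x (sqrt ((1 / \<bar>h\<bar>) powr (2 / \<alpha>) - \<epsilon>\<^sup>2))"
    using bound unfolding maximal_distance_def R_def[symmetric] r_def by blast
qed

section \<open>Circular motions and non-equivalence of the flows\<close>

text \<open>A circular motion sits at a zero of \<open>radial_slope\<close>. The slope is positive
  at 0, which is where \<open>\<epsilon> < \<bar>h\<bar> powr (-1 / \<alpha>)\<close> enters, and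
  nonpositive at \<open>S\<close>, so the intermediate value theorem gives a zero.\<close>

lemma smoothed_equilibrium_exists:
  assumes "2 \<le> \<alpha>" "h < 0" "0 < \<epsilon>" "\<epsilon> < \<bar>h\<bar> powr (-1 / \<alpha>)"
  shows "\<exists>p. (\<lambda>t. p) \<in> trajectories \<alpha> h \<epsilon>"
proof -
  define H where "H = \<bar>h\<bar>"
  define S where "S = (1 / H) powr (2 / \<alpha>)"
  define B where "B s = (s + \<epsilon>\<^sup>2) powr (- (\<alpha> / 2) - 1)" for s
  have H: "0 < H" using assms(2) by (simp add: H_def)
  have pos: "0 < s + \<epsilon>\<^sup>2" if "0 \<le> s" for s using that assms(3) by (auto intro: add_nonneg_pos)
  have AB: "(s + \<epsilon>\<^sup>2) powr (- (\<alpha> / 2)) = (s + \<epsilon>\<^sup>2) * B s" if "0 \<le> s" for s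
    unfolding B_def by (rule powr_split_one[OF pos[OF that]])
  have S: "0 < S" using H by (simp add: S_def)
  have half: "\<epsilon> powr \<alpha> < 1 / H"
  proof -
    have "\<epsilon> powr \<alpha> < (H powr (-1 / \<alpha>)) powr \<alpha>"
      using assms by (intro powr_less_mono2) (auto simp: H_def)
    also have "\<dots> = H powr (- 1)"
      using assms(1) by (subst powr_powr) simp
    finally show ?thesis using H by (simp add: powr_minus_divide)
  qed
  have "(\<epsilon>\<^sup>2) powr (- (\<alpha> / 2)) = (\<epsilon> powr 2) powr (- (\<alpha> / 2))"
    using powr_realpow[OF assms(3), of 2] by simp
  also have "\<dots> = 1 / \<epsilon> powr \<alpha>"
    by (simp add: powr_powr powr_minus_divide)
  finally have "H < (\<epsilon>\<^sup>2) powr (- (\<alpha> / 2))"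
    using half assms(3) H by (simp add: pos_less_divide_eq mult.commute)
  then have lower: "0 < radial_slope \<alpha> H \<epsilon> 0"
    using AB[of 0] by (simp add: radial_slope_def B_def mult.commute)
  have upper: "radial_slope \<alpha> H \<epsilon> S \<le> 0"
  proof -
    have "(S + \<epsilon>\<^sup>2) powr (- (\<alpha> / 2)) \<le> S powr (- (\<alpha> / 2))"
      using assms(1) S by (intro powr_mono2') auto
    also have "\<dots> = H"
      using assms(1) H by (simp add: S_def powr_powr powr_minus powr_divide)
    finally have "(S + \<epsilon>\<^sup>2) * B S \<le> H" using AB[of S] S by simp
    moreover have "(\<epsilon>\<^sup>2 - (\<alpha> / 2 - 1) * S) * B S \<le> (S + \<epsilon>\<^sup>2) * B S"
      using assms(1) S by (intro mult_right_mono) (auto simp: B_def algebra_simps)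
    ultimately show ?thesis by (simp add: radial_slope_def B_def mult.commute)
  qed
  have "continuous_on {0..S} (radial_slope \<alpha> H \<epsilon>)"
    unfolding radial_slope_def[abs_def] using pos
    by (intro continuous_intros) force+
  then obtain s where s: "0 \<le> s" "s \<le> S" "radial_slope \<alpha> H \<epsilon> s = 0"
    using IVT2'[of "radial_slope \<alpha> H \<epsilon>" S 0 0] lower upper S by auto
  with lower have s0: "0 < s" by (cases "s = 0") auto
  have HB: "H = B s * (\<epsilon>\<^sup>2 - (\<alpha> / 2 - 1) * s)"
    using s(3) by (simp add: radial_slope_def B_def)
  define r where "r = sqrt s"
  \<comment> \<open>With \<open>v = 0\<close> both \<open>r'\<close> and \<open>u'\<close> vanish;
    this \<open>u\<close> balances the force so that \<open>v'\<close> vanishes too. The energy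
    relation then amounts to \<open>HB\<close>.\<close>
  define u where "u = sqrt (\<alpha> * r powr \<alpha> * s * B s)"
  have r: "0 < r" "r\<^sup>2 = s" using s0 by (auto simp: r_def)
  have u2: "u\<^sup>2 = \<alpha> * r powr \<alpha> * s * B s"
    using assms(1) s0 by (simp add: u_def B_def)
  have K: "\<alpha> * r powr (\<alpha> + 2) / (r\<^sup>2 + \<epsilon>\<^sup>2) powr (\<alpha> / 2 + 1) = \<alpha> * r powr \<alpha> * s * B s"
    using powr_minus_divide[of "s + \<epsilon>\<^sup>2" "\<alpha> / 2 + 1"] r powr_realpow[of r 2]
    by (simp add: B_def powr_add)
  have "2 * r powr \<alpha> / (r\<^sup>2 + \<epsilon>\<^sup>2) powr (\<alpha> / 2) - 2 * r powr \<alpha> * H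
      = 2 * r powr \<alpha> * ((s + \<epsilon>\<^sup>2) powr (- (\<alpha> / 2)) - H)"
    by (simp add: r powr_minus_divide algebra_simps)
  also have "\<dots> = 2 * r powr \<alpha> * ((s + \<epsilon>\<^sup>2) * B s - B s * (\<epsilon>\<^sup>2 - (\<alpha> / 2 - 1) * s))"
    using AB[of s] s(1) HB by simp
  also have "\<dots> = u\<^sup>2" unfolding u2 by (simp add: field_simps)
  finally have "(r, 0, u) \<in> phase_space \<alpha> h \<epsilon>"
    using r(1) assms(3) by (simp add: phase_space_def energy_surface_def H_def)
  moreover have "reduced_field \<alpha> \<epsilon> (r, 0, u) = 0"
    using assms(3) by (simp add: reduced_field_def K u2 zero_prod_def)
  ultimately show ?thesis
    by (intro exI[of _ "(r, 0, u)"]) (auto simp: trajectories_def intro: has_vector_derivative_const)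
qed

text \<open>An equivalence would carry the equilibrium of the smoothed flow to a constant trajectory
  of the real flow, whatever the change of time. Real trajectories have \<open>r > 0\<close> and
  \<open>r\<close> tending to 0, so none is constant.\<close>

lemma flows_not_equivalent:
  assumes "2 \<le> \<alpha>" "h < 0" "0 < \<epsilon>" "\<epsilon> < \<bar>h\<bar> powr (-1 / \<alpha>)"
  shows "\<not> topologically_equivalent
    (phase_space \<alpha> h 0) (trajectories \<alpha> h 0) (phase_space \<alpha> h \<epsilon>) (trajectories \<alpha> h \<epsilon>)"
proof
  assume "topologically_equivalent
    (phase_space \<alpha> h 0) (trajectories \<alpha> h 0) (phase_space \<alpha> h \<epsilon>) (trajectories \<alpha> h \<epsilon>)"
  then obtain g where g: "\<And>y. y \<in> trajectories \<alpha> h \<epsilon> \<Longrightarrow>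
      \<exists>\<sigma>. strict_mono \<sigma> \<and> surj \<sigma> \<and> g \<circ> y \<circ> \<sigma> \<in> trajectories \<alpha> h 0"
    unfolding topologically_equivalent_def by blast
  obtain p where "(\<lambda>t. p) \<in> trajectories \<alpha> h \<epsilon>"
    using smoothed_equilibrium_exists[OF assms] by blast
  from g[OF this] have const: "(\<lambda>t. g p) \<in> trajectories \<alpha> h 0" by (auto simp: comp_def)
  then have "((\<lambda>t::real. fst (g p)) \<longlongrightarrow> 0) at_top"
    using real_flow_collision(1)[OF const assms(1,2)] by (simp add: leads_to_collision_def)
  then have "fst (g p) = 0" by (simp add: tendsto_const_iff)
  then show False using trajectory_derivatives(1)[OF const] by simp
qed

section \<open>Periodic orbits of the smoothed flow\<close>

text \<open>In the coordinate \<open>\<rho> = ln r\<close> the velocity is \<open>v\<close>, and on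
  a momentum surface \<open>u\<close> and the square of \<open>v\<close> are functions of
  \<open>r\<close>. The flow becomes \<open>\<rho>'' = f \<rho>\<close> with
  \<open>v^2 = \<Gamma> \<rho>\<close>, so \<open>second_order_periodic\<close> applies.\<close>

lemma smoothed_periodic:
  assumes x: "x \<in> trajectories \<alpha> h \<epsilon>" "range x \<subseteq> momentum_surface \<alpha> c"
    and "2 \<le> \<alpha>" "h < 0" "\<epsilon> \<noteq> 0" "c \<noteq> 0"
  shows "periodic_curve x"
proof -
  define r where "r t = fst (x t)" for t
  define v where "v t = fst (snd (x t))" for t
  define H where "H = \<bar>h\<bar>"
  define S where "S = (1 / H) powr (2 / \<alpha>)"
  define B where "B s = (s + \<epsilon>\<^sup>2) powr (- (\<alpha> / 2) - 1)" for s
  have H: "0 < H" using assms(4) by (simp add: H_def)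
  have pos: "0 < s + \<epsilon>\<^sup>2" if "0 \<le> s" for s using that assms(5) by (auto intro: add_nonneg_pos)
  have AB: "(s + \<epsilon>\<^sup>2) powr (- (\<alpha> / 2)) = (s + \<epsilon>\<^sup>2) * B s" if "0 \<le> s" for s
    unfolding B_def by (rule powr_split_one[OF pos[OF that]])
  have u: "snd (snd (x t)) = c * r t powr ((\<alpha> - 2) / 2)" for t
    using subsetD[OF x(2) rangeI[of x t]] by (auto simp: momentum_surface_def r_def)
  note traj = trajectory_derivatives[OF x(1), folded r_def v_def]
    and smooth = smoothed_trajectory[OF x(1) assms(5), folded r_def v_def H_def]
  define k where "k s = - ((\<alpha> - 2) / 2) * c\<^sup>2 + \<alpha> * s * (\<epsilon>\<^sup>2 * B s - H)" for s
  define f where "f \<rho> = exp ((\<alpha> - 2) * \<rho>) * k (exp (2 * \<rho>))" for \<rho>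
  define \<Gamma> where "\<Gamma> \<rho> = exp ((\<alpha> - 2) * \<rho>) * radial_energy \<alpha> H \<epsilon> c (exp (2 * \<rho>))" for \<rho>
  \<comment> \<open>Equivalently, \<open>f\<close> is half the derivative of
    \<open>\<Gamma>\<close>. Thus a common zero of \<open>f\<close> and \<open>\<Gamma>\<close> is a
    critical point of \<open>radial_energy\<close> on the level 0.\<close>
  have k_eq: "k s = (\<alpha> - 2) / 2 * radial_energy \<alpha> H \<epsilon> c s + s * radial_slope \<alpha> H \<epsilon> s" if "0 \<le> s" for s
    unfolding k_def radial_energy_def radial_slope_def AB[OF that] B_def[symmetric]
    by (simp add: field_simps)
  have P: "exp ((\<alpha> - 2) * ln (r t)) = r t powr (\<alpha> - 2)" "exp (2 * ln (r t)) = (r t)\<^sup>2"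
    "r t powr \<alpha> = r t powr (\<alpha> - 2) * (r t)\<^sup>2"
    "(snd (snd (x t)))\<^sup>2 = c\<^sup>2 * r t powr (\<alpha> - 2)" for t
  proof -
    show "exp ((\<alpha> - 2) * ln (r t)) = r t powr (\<alpha> - 2)"
      using traj(1)[of t] by (simp add: powr_def)
    show r2: "exp (2 * ln (r t)) = (r t)\<^sup>2"
      using traj(1)[of t] powr_realpow[of "r t" 2] by (simp add: powr_def)
    show "r t powr \<alpha> = r t powr (\<alpha> - 2) * (r t)\<^sup>2"
      using traj(1)[of t] powr_add[of "r t" "\<alpha> - 2" 2] powr_realpow[of "r t" 2] by simp
    show "(snd (snd (x t)))\<^sup>2 = c\<^sup>2 * r t powr (\<alpha> - 2)"
      unfolding u power_mult_distrib power2_eq_square[of "_ powr _"] powr_add[symmetric] by simp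
  qed
  have v2: "(v t)\<^sup>2 = \<Gamma> (ln (r t))" for t
  proof -
    have "(v t)\<^sup>2 = 2 * r t powr \<alpha> * (((r t)\<^sup>2 + \<epsilon>\<^sup>2) powr (- (\<alpha> / 2)) - H) - (snd (snd (x t)))\<^sup>2"
      using smooth(2)[of t] by simp
    then show ?thesis unfolding P(4) P(3) \<Gamma>_def P(1,2) radial_energy_def
      by (simp add: algebra_simps)
  qed
  have dv: "(v has_real_derivative f (ln (r t))) (at t)" for t
  proof -
    let ?u = "snd (snd (x t))" and ?Q = "r t powr (\<alpha> - 2)" and ?s = "(r t)\<^sup>2"
    have "?u\<^sup>2 + \<alpha> / 2 * (v t)\<^sup>2 - \<alpha> * r t powr \<alpha> * ?s * B ?s = ?Q * k ?s"
      unfolding v2 P \<Gamma>_def radial_energy_def AB[OF zero_le_power2] k_def by (simp add: field_simps)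
    then show ?thesis
      using smooth(1)[of t] unfolding f_def P(1,2) by (simp add: B_def)
  qed
  have dx: "((\<lambda>t. ln (r t)) has_real_derivative v t) (at t)" for t
    using traj(1)[of t] by (auto intro!: derivative_eq_intros traj(2))
  \<comment> \<open>\<open>A\<close> bounds
    \<open>(s + \<epsilon>^2) powr (- (\<alpha> / 2))\<close> for \<open>s \<ge> 0\<close>. With
    \<open>c \<noteq> 0\<close> the centrifugal term then forces
    \<open>r^2 \<ge> c^2 / (2 * A)\<close>, which keeps \<open>ln r\<close> in a compact
    interval.\<close>
  define A where "A = (\<epsilon>\<^sup>2) powr (- (\<alpha> / 2))"
  have A: "0 < A" using assms(5) by (simp add: A_def)
  define a where "a = ln (c\<^sup>2 / (2 * A)) / 2"
  define b where "b = ln S / 2"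
  have range: "ln (r t) \<in> {a..b}" for t
  proof -
    let ?s = "(r t)\<^sup>2"
    have s: "0 < ?s" using traj(1)[of t] by simp
    have "0 \<le> radial_energy \<alpha> H \<epsilon> c ?s"
      using zero_le_power2[of "v t"] traj(1)[of t] unfolding v2 \<Gamma>_def P by (simp add: zero_le_mult_iff)
    then have "c\<^sup>2 \<le> 2 * ?s * ((?s + \<epsilon>\<^sup>2) powr (- (\<alpha> / 2)) - H)"
      by (simp add: radial_energy_def)
    also have "\<dots> \<le> 2 * ?s * A"
    proof -
      have "(?s + \<epsilon>\<^sup>2) powr (- (\<alpha> / 2)) \<le> A"
        unfolding A_def using assms(3,5) by (intro powr_mono2') auto
      then show ?thesis using H by (intro mult_left_mono) auto
    qed
    finally have "c\<^sup>2 / (2 * A) \<le> ?s" using A by (simp add: field_simps)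
    then have "ln (c\<^sup>2 / (2 * A)) \<le> ln ?s"
      using s A assms(6) by (intro ln_mono) auto
    moreover have "?s \<le> S"
      unfolding S_def H_def r_def
      by (rule order_trans[OF _ smoothed_reach[OF x(1) assms(5), of t]]) (use assms(3,4) in auto)
    then have "ln ?s \<le> ln S" using s by (intro ln_mono) auto
    moreover have "ln ?s = 2 * ln (r t)" using traj(1)[of t] by (simp add: ln_realpow)
    ultimately show ?thesis by (simp add: a_def b_def)
  qed
  define k' where "k' s = \<alpha> * (\<epsilon>\<^sup>2 * B s - H) +
    \<alpha> * s * (\<epsilon>\<^sup>2 * ((- (\<alpha> / 2) - 1) * (s + \<epsilon>\<^sup>2) powr (- 2 - \<alpha> / 2)))" for s
  have dk: "(k has_real_derivative k' s) (at s)" if "0 \<le> s" for s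
    unfolding k_def[abs_def] k'_def B_def using pos[OF that]
    by (auto intro!: derivative_eq_intros)
  define f' where "f' \<rho> = (\<alpha> - 2) * f \<rho> + exp ((\<alpha> - 2) * \<rho>) * (k' (exp (2 * \<rho>)) * (2 * exp (2 * \<rho>)))" for \<rho>
  have df: "(f has_real_derivative f' \<rho>) (at \<rho>)" for \<rho>
  proof -
    have "((\<lambda>\<rho>. exp (2 * \<rho>)) has_real_derivative 2 * exp (2 * \<rho>)) (at \<rho>)"
      by (auto intro!: derivative_eq_intros)
    from DERIV_chain2[OF dk this]
    have "((\<lambda>\<rho>. k (exp (2 * \<rho>))) has_real_derivative k' (exp (2 * \<rho>)) * (2 * exp (2 * \<rho>))) (at \<rho>)"
      by simp
    moreover have "((\<lambda>\<rho>. exp ((\<alpha> - 2) * \<rho>)) has_real_derivative (\<alpha> - 2) * exp ((\<alpha> - 2) * \<rho>)) (at \<rho>)"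
      by (auto intro!: derivative_eq_intros)
    ultimately show ?thesis
      unfolding f_def[abs_def] f'_def using DERIV_mult by (fastforce simp: algebra_simps)
  qed
  have pos': "exp (2 * \<rho>) + \<epsilon>\<^sup>2 \<noteq> 0" for \<rho> :: real
    using pos[of "exp (2 * \<rho>)"] by simp
  have "continuous_on {a..b} f'" "continuous_on {a..b} \<Gamma>"
    unfolding f'_def[abs_def] f_def[abs_def] k'_def k_def B_def \<Gamma>_def[abs_def] radial_energy_def
    by (intro continuous_intros; simp add: pos')+
  moreover have "w = z" if "f z = 0" "\<Gamma> z = 0" "0 \<le> \<Gamma> w" for z w
  proof -
    have E: "radial_energy \<alpha> H \<epsilon> c (exp (2 * z)) = 0" using that(2) by (simp add: \<Gamma>_def)
    moreover have "k (exp (2 * z)) = 0" using that(1) by (simp add: f_def)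
    ultimately have "radial_slope \<alpha> H \<epsilon> (exp (2 * z)) = 0" by (simp add: k_eq)
    moreover have "0 \<le> radial_energy \<alpha> H \<epsilon> c (exp (2 * w))"
      using that(3) by (simp add: \<Gamma>_def zero_le_mult_iff)
    ultimately have "exp (2 * w) = exp (2 * z)"
      using E radial_energy_peak[OF assms(3) H assms(5), of "exp (2 * z)" "exp (2 * w)" c] by simp
    then show ?thesis by simp
  qed
  ultimately have "\<exists>T>0. \<forall>t. ln (r (t + T)) = ln (r t) \<and> v (t + T) = v t"
    by (intro second_order_periodic[where \<Gamma> = \<Gamma>, OF dx dv range df _ _ v2]) auto
  then obtain T where T: "0 < T" "\<And>t. ln (r (t + T)) = ln (r t)" "\<And>t. v (t + T) = v t" by blast
  \<comment> \<open>\<open>ln\<close> is injective on positive \<open>r\<close>, and the momentum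
    surface recovers \<open>u\<close> from \<open>r\<close>.\<close>
  have "r (t + T) = r t" for t using T(2)[of t] traj(1) by simp
  then have "x (t + T) = x t" for t
    using T(3)[of t] u by (simp add: prod_eq_iff flip: r_def v_def)
  then show ?thesis using T(1) unfolding periodic_curve_def by blast
qed

text \<open>
  With \<open>\<alpha> = 2\<close>, \<open>s = (norm q)\<^sup>2\<close> satisfies a second-order equation in physical time that is regular at \<open>s = 0\<close>,
  so motions through the origin need no separate treatment.
\<close>

lemma planar_periodic:
  assumes motion: "planar_motion 2 h \<epsilon> q p" and "h < 0" "\<epsilon> \<noteq> 0"
  shows "periodic_curve (\<lambda>t. reduced_state 2 (q t) (p t))"
proof -
  define H where "H = \<bar>h\<bar>"
  have H: "0 < H" "h = - H" using assms(2) by (auto simp: H_def)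
  define s where "s t = q t \<bullet> q t" for t
  define y where "y t = 2 * (q t \<bullet> p t)" for t
  \<comment> \<open>The angular momentum \<open>p_\<theta>\<close>, written as an inner product with
    \<open>q\<close> rotated by a right angle so that the product rule for inner products
    applies.\<close>
  define c where "c t = (\<i> * q t) \<bullet> p t" for t
  define A where "A s = (s + \<epsilon>\<^sup>2) powr (- (2 / 2))" for s :: real
  have s: "0 \<le> s t" "s t = (norm (q t))\<^sup>2" for t by (simp_all add: s_def power2_norm_eq_inner)
  have pos: "0 < s + \<epsilon>\<^sup>2" if "0 \<le> s" for s using that assms(3) by (auto intro: add_nonneg_pos)
  have dq: "(q has_vector_derivative p t) (at t)"
    and dp: "(p has_vector_derivative (- 2 * (s t + \<epsilon>\<^sup>2) powr (- 2)) *\<^sub>R q t) (at t)"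
    and energy: "p t \<bullet> p t = 2 * (A (s t) - H)" for t
  proof -
    note m = motion[unfolded planar_motion_def, rule_format, of t, folded s(2)]
    show "(q has_vector_derivative p t) (at t)" using m by blast
    have "- 2 / (s t + \<epsilon>\<^sup>2) powr (2 / 2 + 1) = - 2 * (s t + \<epsilon>\<^sup>2) powr (- 2)"
      using powr_minus_divide[of "s t + \<epsilon>\<^sup>2" 2] by simp
    then show "(p has_vector_derivative (- 2 * (s t + \<epsilon>\<^sup>2) powr (- 2)) *\<^sub>R q t) (at t)"
      using m by metis
    show "p t \<bullet> p t = 2 * (A (s t) - H)"
      using m unfolding H(2) A_def powr_minus_divide power2_norm_eq_inner by argo
  qed
  have ds: "(s has_real_derivative y t) (at t)" for t
    using bounded_bilinear.has_vector_derivative[OF bounded_bilinear_inner dq[of t] dq[of t]]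
    by (simp add: has_real_derivative_iff_has_vector_derivative s_def[abs_def] y_def inner_commute)
  have dc: "(c has_real_derivative 0) (at t)" for t
    using bounded_bilinear.has_vector_derivative[OF bounded_bilinear_inner
        has_vector_derivative_mult_right[OF dq[of t], of \<i>] dp[of t]]
    by (simp add: has_real_derivative_iff_has_vector_derivative c_def[abs_def] inner_complex_def)
  then obtain C where C: "\<And>t. c t = C" using DERIV_isconst_all[of c] by metis
  \<comment> \<open>Lagrange's identity in the plane: the squared radial and angular products add up
    to \<open>(q \<bullet> q) * (p \<bullet> p)\<close>.\<close>
  have split: "(y t)\<^sup>2 = 4 * (s t * (p t \<bullet> p t) - C\<^sup>2)" for t
    unfolding y_def s_def C[of t, symmetric] c_def
    by (simp add: inner_complex_def power2_eq_square algebra_simps)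
  then have y2: "(y t)\<^sup>2 = 4 * radial_energy 2 H \<epsilon> C (s t)" for t
    unfolding energy radial_energy_def by (simp add: A_def)
  have dy: "(y has_real_derivative 2 * radial_slope 2 H \<epsilon> (s t)) (at t)" for t
  proof -
    have "(y has_real_derivative 2 * (- 2 * (s t + \<epsilon>\<^sup>2) powr (- 2) * s t + 2 * (A (s t) - H))) (at t)"
      using has_vector_derivative_mult_right[OF
          bounded_bilinear.has_vector_derivative[OF bounded_bilinear_inner dq[of t] dp[of t]], of 2]
      by (simp add: has_real_derivative_iff_has_vector_derivative y_def[abs_def] s_def energy)
    moreover have "A (s t) = (s t + \<epsilon>\<^sup>2) * (s t + \<epsilon>\<^sup>2) powr (- 2)"
      unfolding A_def using powr_split_one[OF pos[OF s(1)[of t]], of "- 1"] by simp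
    ultimately show ?thesis by (simp add: radial_slope_def algebra_simps)
  qed
  have range: "s t \<in> {0..1 / H}" for t
  proof -
    have "H \<le> (s t + \<epsilon>\<^sup>2) powr (- (2 / 2))"
      using energy[of t] inner_ge_zero[of "p t"] by (simp add: A_def)
    from reach_bound[OF _ H(1) pos[OF s(1)] this] have "s t + \<epsilon>\<^sup>2 \<le> 1 / H"
      using H(1) by simp
    then show ?thesis
      using s(1)[of t] zero_le_power2[of \<epsilon>] unfolding atLeastAtMost_iff by linarith
  qed
  have df: "((\<lambda>s. 2 * radial_slope 2 H \<epsilon> s) has_real_derivative - 8 * \<epsilon>\<^sup>2 * (z + \<epsilon>\<^sup>2) powr (- 3)) (at z)"
    if "z \<in> {0..1 / H}" for z
    unfolding radial_slope_def using pos[of z] that by (auto intro!: derivative_eq_intros)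
  have "z + \<epsilon>\<^sup>2 \<noteq> 0" if "z \<in> {0..1 / H}" for z using pos[of z] that by simp
  then have "continuous_on {0..1 / H} (\<lambda>z. - 8 * \<epsilon>\<^sup>2 * (z + \<epsilon>\<^sup>2) powr (- 3))"
    "continuous_on {0..1 / H} (\<lambda>z. 4 * radial_energy 2 H \<epsilon> C z)"
    unfolding radial_energy_def by (intro continuous_intros ballI; assumption)+
  moreover have "w = z" if "z \<in> {0..1 / H}" "2 * radial_slope 2 H \<epsilon> z = 0" "4 * radial_energy 2 H \<epsilon> C z = 0"
    "w \<in> {0..1 / H}" "0 \<le> 4 * radial_energy 2 H \<epsilon> C w" for z w
    using that radial_energy_peak[OF order_refl H(1) assms(3), of z w C] by simp
  ultimately have "\<exists>T>0. \<forall>t. s (t + T) = s t \<and> y (t + T) = y t"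
    by (intro second_order_periodic[where \<Gamma> = "\<lambda>z. 4 * radial_energy 2 H \<epsilon> C z",
        OF ds dy range df _ _ y2]) auto
  then obtain T where T: "0 < T" "\<And>t. s (t + T) = s t" "\<And>t. y (t + T) = y t" by blast
  \<comment> \<open>The reduced state depends only on \<open>s\<close>, \<open>y\<close> and the
    constant \<open>C\<close>, also at \<open>q = 0\<close> where division by the norm yields 0;
    hence it inherits the period \<open>T\<close>.\<close>
  have "Im (cnj (q t) * p t) = C" for t
    unfolding C[of t, symmetric] c_def by (simp add: inner_complex_def)
  then have "reduced_state 2 (q t) (p t) =
      (sqrt (s t), y t / 2 / sqrt (s t) * sqrt (s t) powr (2 / 2), C * sqrt (s t) powr ((2 - 2) / 2))" for t
    unfolding reduced_state_def y_def s(2) by simp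
  then show ?thesis
    using T unfolding periodic_curve_def by (intro exI[of _ T]) simp
qed

section \<open>Assembly of the two cases\<close>

theorem mainTheorem2:
  fixes \<alpha> h :: real
  assumes "h < 0"
  shows
    "(\<alpha> = 2 \<longrightarrow>
        (\<forall>\<epsilon>\<in>{0<..<\<bar>h\<bar> powr (-1 / \<alpha>)}.
           (\<forall>x\<in>trajectories \<alpha> h 0. leads_to_collision x \<and> escapes_from_collision x) \<and>
           (\<forall>c. c \<noteq> 0 \<longrightarrow>
              (\<forall>x\<in>trajectories \<alpha> h \<epsilon>. range x \<subseteq> momentum_surface \<alpha> c \<longrightarrow> periodic_curve x)) \<and>
           (\<forall>q p. planar_motion \<alpha> h \<epsilon> q p \<longrightarrow>
              periodic_curve (\<lambda>t. reduced_state \<alpha> (q t) (p t))) \<and>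
           \<not> topologically_equivalent
               (phase_space \<alpha> h 0) (trajectories \<alpha> h 0)
               (phase_space \<alpha> h \<epsilon>) (trajectories \<alpha> h \<epsilon>)))
     \<and>
     (\<alpha> > 2 \<longrightarrow>
        (\<forall>\<epsilon>\<in>{0<..<\<bar>h\<bar> powr (-1 / \<alpha>)}.
           (\<forall>x\<in>trajectories \<alpha> h 0. leads_to_collision x \<and> escapes_from_collision x) \<and>
           (\<forall>x\<in>trajectories \<alpha> h \<epsilon>. range x \<subseteq> momentum_surface \<alpha> 0 \<longrightarrow>
              escapes_from_collision x \<and> leads_to_collision x \<and>
              (\<forall>\<tau>. snd (snd (x \<tau>)) = 0) \<and>
              maximal_distance x (sqrt ((1 / \<bar>h\<bar>) powr (2 / \<alpha>) - \<epsilon>\<^sup>2))) \<and>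
           \<not> topologically_equivalent
               (phase_space \<alpha> h 0) (trajectories \<alpha> h 0)
               (phase_space \<alpha> h \<epsilon>) (trajectories \<alpha> h \<epsilon>)) \<and>
        (\<exists>\<epsilon>\<^sub>0>0. \<forall>\<epsilon>\<in>{0<..<\<bar>h\<bar> powr (-1 / \<alpha>)}. \<epsilon> < \<epsilon>\<^sub>0 \<longrightarrow>
           (\<forall>c. c \<noteq> 0 \<longrightarrow> phase_space \<alpha> h \<epsilon> \<inter> momentum_surface \<alpha> c \<noteq> {} \<longrightarrow>
              (\<forall>x\<in>trajectories \<alpha> h \<epsilon>. range x \<subseteq> momentum_surface \<alpha> c \<longrightarrow> periodic_curve x))))"
proof (intro conjI impI)
  assume \<alpha>: "\<alpha> = 2"
  show "\<forall>\<epsilon>\<in>{0<..<\<bar>h\<bar> powr (-1 / \<alpha>)}.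
      (\<forall>x\<in>trajectories \<alpha> h 0. leads_to_collision x \<and> escapes_from_collision x) \<and>
      (\<forall>c. c \<noteq> 0 \<longrightarrow>
         (\<forall>x\<in>trajectories \<alpha> h \<epsilon>. range x \<subseteq> momentum_surface \<alpha> c \<longrightarrow> periodic_curve x)) \<and>
      (\<forall>q p. planar_motion \<alpha> h \<epsilon> q p \<longrightarrow> periodic_curve (\<lambda>t. reduced_state \<alpha> (q t) (p t))) \<and>
      \<not> topologically_equivalent
          (phase_space \<alpha> h 0) (trajectories \<alpha> h 0) (phase_space \<alpha> h \<epsilon>) (trajectories \<alpha> h \<epsilon>)" (is "\<forall>\<epsilon>\<in>_. ?P \<epsilon>")
  proof
    fix \<epsilon> assume "\<epsilon> \<in> {0<..<\<bar>h\<bar> powr (-1 / \<alpha>)}"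
    then have \<epsilon>: "0 < \<epsilon>" "\<epsilon> < \<bar>h\<bar> powr (-1 / \<alpha>)" "\<epsilon> \<noteq> 0" and "2 \<le> \<alpha>" using \<alpha> by auto
    then show "?P \<epsilon>"
      using \<alpha> assms real_flow_collision[of _ \<alpha> h] smoothed_periodic[of _ \<alpha> h \<epsilon>] planar_periodic[of h \<epsilon>]
        flows_not_equivalent[of \<alpha> h \<epsilon>]
      by (intro conjI allI ballI impI) simp_all
  qed
next
  assume \<alpha>: "\<alpha> > 2"
  show "\<forall>\<epsilon>\<in>{0<..<\<bar>h\<bar> powr (-1 / \<alpha>)}.
      (\<forall>x\<in>trajectories \<alpha> h 0. leads_to_collision x \<and> escapes_from_collision x) \<and>
      (\<forall>x\<in>trajectories \<alpha> h \<epsilon>. range x \<subseteq> momentum_surface \<alpha> 0 \<longrightarrow>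
         escapes_from_collision x \<and> leads_to_collision x \<and>
         (\<forall>\<tau>. snd (snd (x \<tau>)) = 0) \<and>
         maximal_distance x (sqrt ((1 / \<bar>h\<bar>) powr (2 / \<alpha>) - \<epsilon>\<^sup>2))) \<and>
      \<not> topologically_equivalent
          (phase_space \<alpha> h 0) (trajectories \<alpha> h 0) (phase_space \<alpha> h \<epsilon>) (trajectories \<alpha> h \<epsilon>)" (is "\<forall>\<epsilon>\<in>_. ?P \<epsilon>")
  proof
    fix \<epsilon> assume "\<epsilon> \<in> {0<..<\<bar>h\<bar> powr (-1 / \<alpha>)}"
    then have \<epsilon>: "0 < \<epsilon>" "\<epsilon> < \<bar>h\<bar> powr (-1 / \<alpha>)" "\<epsilon> \<noteq> 0" and "2 \<le> \<alpha>" "0 < \<alpha>" "h \<noteq> 0"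
      using \<alpha> assms by auto
    then show "?P \<epsilon>"
      using assms real_flow_collision[of _ \<alpha> h] smoothed_ejection_collision[of _ \<alpha> h \<epsilon>]
        flows_not_equivalent[of \<alpha> h \<epsilon>]
      by (intro conjI allI ballI impI) metis+
  qed
  show "\<exists>\<epsilon>\<^sub>0>0. \<forall>\<epsilon>\<in>{0<..<\<bar>h\<bar> powr (-1 / \<alpha>)}. \<epsilon> < \<epsilon>\<^sub>0 \<longrightarrow>
      (\<forall>c. c \<noteq> 0 \<longrightarrow> phase_space \<alpha> h \<epsilon> \<inter> momentum_surface \<alpha> c \<noteq> {} \<longrightarrow>
         (\<forall>x\<in>trajectories \<alpha> h \<epsilon>. range x \<subseteq> momentum_surface \<alpha> c \<longrightarrow> periodic_curve x))"
    \<comment> \<open>The threshold 1 is an arbitrary choice, as \<open>smoothed_periodic\<close> is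
      stated for all \<open>\<epsilon> \<noteq> 0\<close>.\<close>
    using \<alpha> assms smoothed_periodic[of _ \<alpha> h] by (intro exI[of _ 1]) auto
qed

end
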